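(* Let $\alpha:[0,1]\to\mathfrak{T}_1$, $\alpha(t)=(A_1(t),A_2(t),A_3(t))$, be a piecewise $C^1$ path. Then $\alpha$ is a geodesic in $\mathfrak{T}_1$ with respect to the metric $\eta$ if and only if there exists some $j\in\{1,2,3\}$ such that for all $t,t'\in[0,1]$ with $t\le t'$ we have $$\frac{A_i(t')}{A_i(t)}\le\frac{A_j(t')}{A_j(t)}\quad\text{for all } i\in\{1,2,3\}.$$
   Context: $\mathbb{R}_+^*$ denotes the set of positive reals. $\mathfrak{T}_1=\{(A_1,A_2,A_3)\in(\mathbb{R}_+^* )^3:(A_1+A_2+A_3)A_1A_2A_3=1\}$ (the space of marked unit area Euclidean triangles), an embedded differentiable submanifold of $(\mathbb{R}_+^* )^3$. The metric $\eta$ on $\mathfrak{T}_1$ (not symmetric) is $\eta((A_1,A_2,A_3),(A_1',A_2',A_3'))=\log\max\{A_1'/A_1,A_2'/A_2,A_3'/A_3\}$. A continuous path $\alpha:[a,b]\to X$ in a (possibly non-symmetric) metric space $(X,d)$ is a geodesic if $d(\alpha(u),\alpha(w))=d(\alpha(u),\alpha(v))+d(\alpha(v),\alpha(w))$ for all $u\le v\le w$ in $[a,b]$. *)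

theory Defs
  imports "HOL-Analysis.Analysis"
begin

definition unit_area_triangles :: "(real ^ 3) set" where
  "unit_area_triangles =
     {A. (\<forall>i. 0 < A $ i) \<and> (A $ 1 + A $ 2 + A $ 3) * A $ 1 * A $ 2 * A $ 3 = 1}"

definition eta :: "real ^ 3 \<Rightarrow> real ^ 3 \<Rightarrow> real" where
  "eta A A' = ln (Max {A' $ 1 / A $ 1, A' $ 2 / A $ 2, A' $ 3 / A $ 3})"

text \<open>
  The function d is a possibly non-symmetric metric on X. The topology on X is that of the
  symmetrised metric max (d x y) (d y x), so continuity asks for closeness in both directions.
\<close>

definition asym_path :: "'a set \<Rightarrow> ('a \<Rightarrow> 'a \<Rightarrow> real) \<Rightarrow> real \<Rightarrow> real \<Rightarrow> (real \<Rightarrow> 'a) \<Rightarrow> bool" where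
  "asym_path X d a b \<alpha> \<longleftrightarrow>
     \<alpha> \<in> {a..b} \<rightarrow> X \<and>
     (\<forall>t\<in>{a..b}. \<forall>\<epsilon>>0. \<exists>\<delta>>0. \<forall>s\<in>{a..b}. \<bar>s - t\<bar> < \<delta> \<longrightarrow> d (\<alpha> t) (\<alpha> s) < \<epsilon> \<and> d (\<alpha> s) (\<alpha> t) < \<epsilon>)"

definition asym_geodesic :: "'a set \<Rightarrow> ('a \<Rightarrow> 'a \<Rightarrow> real) \<Rightarrow> real \<Rightarrow> real \<Rightarrow> (real \<Rightarrow> 'a) \<Rightarrow> bool" where
  "asym_geodesic X d a b \<alpha> \<longleftrightarrow>
     asym_path X d a b \<alpha> \<and>
     (\<forall>u\<in>{a..b}. \<forall>v\<in>{a..b}. \<forall>w\<in>{a..b}. u \<le> v \<and> v \<le> w \<longrightarrow>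
        d (\<alpha> u) (\<alpha> w) = d (\<alpha> u) (\<alpha> v) + d (\<alpha> v) (\<alpha> w))"

end

theory Submission
  imports Defs
begin

text \<open>
  Let \<open>j\<close> attain the maximum defining \<open>eta (\<alpha> 0) (\<alpha> 1)\<close>. Every \<open>ln (\<alpha> t' $ j / \<alpha> t $ j)\<close> is at most
  \<open>eta (\<alpha> t) (\<alpha> t')\<close>, and both quantities are additive along a geodesic; since they agree on the whole
  interval, they agree on each subinterval, so \<open>j\<close> attains the maximum everywhere. Conversely, a
  coordinate that attains every maximum makes \<open>eta\<close> a difference of logarithms, hence additive.
\<close>

lemma unit_area_triangles_pos: "A \<in> unit_area_triangles \<Longrightarrow> 0 < A $ i"
  by (simp add: unit_area_triangles_def)

lemma ln_ratio_le_eta: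
  assumes "A \<in> unit_area_triangles" "B \<in> unit_area_triangles"
  shows "ln (B $ i) - ln (A $ i) \<le> eta A B"
proof -
  have "B $ i / A $ i \<le> Max {B $ 1 / A $ 1, B $ 2 / A $ 2, B $ 3 / A $ 3}"
    using exhaust_3[of i] by (auto intro!: Max_ge)
  moreover have "0 < A $ i" "0 < B $ i"
    using assms by (simp_all add: unit_area_triangles_pos)
  ultimately show ?thesis
    unfolding eta_def
    by (metis divide_pos_pos ln_divide_pos ln_mono)
qed

lemma eta_attained:
  assumes "A \<in> unit_area_triangles" "B \<in> unit_area_triangles"
  obtains j where "eta A B = ln (B $ j) - ln (A $ j)"
proof -
  have "Max {B $ 1 / A $ 1, B $ 2 / A $ 2, B $ 3 / A $ 3}
      \<in> {B $ 1 / A $ 1, B $ 2 / A $ 2, B $ 3 / A $ 3}"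
    by (rule Max_in) auto
  then obtain j where "Max {B $ 1 / A $ 1, B $ 2 / A $ 2, B $ 3 / A $ 3} = B $ j / A $ j"
    by blast
  then have "eta A B = ln (B $ j) - ln (A $ j)"
    using assms by (simp add: eta_def ln_divide_pos unit_area_triangles_pos)
  then show ?thesis ..
qed

text \<open>\<open>eta A B\<close> is the largest of the three log ratios. If it equals the one at
  \<open>j\<close>, that one bounds the others; if \<open>j\<close> dominates, the log ratio
  attaining \<open>eta A B\<close> is at most the one at \<open>j\<close>, which is itself at most
  \<open>eta A B\<close>.\<close>

lemma eta_eq_iff:
  assumes "A \<in> unit_area_triangles" "B \<in> unit_area_triangles"
  shows "eta A B = ln (B $ j) - ln (A $ j) \<longleftrightarrow> (\<forall>i. B $ i / A $ i \<le> B $ j / A $ j)"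
proof -
  have pos: "0 < A $ i" "0 < B $ i" for i
    using assms by (simp_all add: unit_area_triangles_pos)
  have le: "B $ i / A $ i \<le> B $ j / A $ j \<longleftrightarrow> ln (B $ i) - ln (A $ i) \<le> ln (B $ j) - ln (A $ j)" for i
    using pos by (metis divide_pos_pos ln_divide_pos ln_le_cancel_iff)
  show ?thesis
    unfolding le by (metis assms eta_attained ln_ratio_le_eta order_antisym)
qed

text \<open>Both arguments vary, so that fixing either one covers both directions of the
  non-symmetric \<open>eta\<close>.\<close>

lemma tendsto_eta:
  assumes "(f \<longlongrightarrow> A) F" "(g \<longlongrightarrow> A) F" "A \<in> unit_area_triangles"
  shows "((\<lambda>s. eta (f s) (g s)) \<longlongrightarrow> 0) F"
proof -
  have pos: "0 < A $ i" for i
    using assms(3) by (rule unit_area_triangles_pos)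
  have ratio: "((\<lambda>s. g s $ i / f s $ i) \<longlongrightarrow> 1) F" for i
    using tendsto_divide[OF tendsto_vec_nth[OF assms(2)] tendsto_vec_nth[OF assms(1)], of i i] pos[of i]
    by simp
  \<comment> \<open>The \<open>Max\<close> over the three ratios is unfolded into nested binary
    maxima, through which limits pass; the limit is ln 1 = 0.\<close>
  have "((\<lambda>s. ln (max (g s $ 1 / f s $ 1) (max (g s $ 2 / f s $ 2) (g s $ 3 / f s $ 3))))
      \<longlongrightarrow> ln (max 1 (max 1 1))) F"
    by (intro tendsto_ln tendsto_max ratio) simp
  then show ?thesis
    by (simp add: eta_def)
qed

lemma continuous_on_imp_asym_path_eta:
  assumes "\<alpha> \<in> {a..b} \<rightarrow> unit_area_triangles" "continuous_on {a..b} \<alpha>"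
  shows "asym_path unit_area_triangles eta a b \<alpha>"
  unfolding asym_path_def
proof (intro conjI ballI allI impI)
  fix t \<epsilon> :: real
  assume t: "t \<in> {a..b}" and "0 < \<epsilon>"
  have lim: "(\<alpha> \<longlongrightarrow> \<alpha> t) (at t within {a..b})"
    using assms(2) t by (simp add: continuous_on_def)
  have At: "\<alpha> t \<in> unit_area_triangles"
    using assms(1) t by blast
  \<comment> \<open>The filter \<open>at t within {a..b}\<close> leaves out s = t, so this point of
    the \<delta>-neighbourhood is treated apart.\<close>
  have eta0: "eta (\<alpha> t) (\<alpha> t) = 0"
    using unit_area_triangles_pos[OF At] by (simp add: eta_def less_imp_neq[symmetric])
  have "\<forall>\<^sub>F s in at t within {a..b}. eta (\<alpha> t) (\<alpha> s) < \<epsilon> \<and> eta (\<alpha> s) (\<alpha> t) < \<epsilon>"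
    using order_tendstoD(2)[OF tendsto_eta[OF tendsto_const lim At] \<open>0 < \<epsilon>\<close>]
      order_tendstoD(2)[OF tendsto_eta[OF lim tendsto_const At] \<open>0 < \<epsilon>\<close>]
    by (rule eventually_conj)
  then show "\<exists>\<delta>>0. \<forall>s\<in>{a..b}. \<bar>s - t\<bar> < \<delta> \<longrightarrow> eta (\<alpha> t) (\<alpha> s) < \<epsilon> \<and> eta (\<alpha> s) (\<alpha> t) < \<epsilon>"
    unfolding eventually_at dist_real_def using eta0 \<open>0 < \<epsilon>\<close> by metis
qed (fact assms(1))

theorem theorem3p3:
  fixes \<alpha> :: "real \<Rightarrow> real ^ 3"
  assumes "\<alpha> \<in> {0..1} \<rightarrow> unit_area_triangles"
    and "\<alpha> piecewise_C1_differentiable_on {0..1}"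
  shows "asym_geodesic unit_area_triangles eta 0 1 \<alpha> \<longleftrightarrow>
    (\<exists>j. \<forall>t\<in>{0..1}. \<forall>t'\<in>{0..1}. t \<le> t' \<longrightarrow>
       (\<forall>i. \<alpha> t' $ i / \<alpha> t $ i \<le> \<alpha> t' $ j / \<alpha> t $ j))"
    (is "_ \<longleftrightarrow> ?dominated")
proof -
  have T: "\<alpha> t \<in> unit_area_triangles" if "t \<in> {0..1}" for t
    using assms(1) that by blast
  \<comment> \<open>In this form the condition is an equation between \<open>eta\<close> and a
    difference of logarithms, which telescopes.\<close>
  have dominated: "?dominated \<longleftrightarrow> (\<exists>j. \<forall>t\<in>{0..1}. \<forall>t'\<in>{0..1}. t \<le> t' \<longrightarrow>
      eta (\<alpha> t) (\<alpha> t') = ln (\<alpha> t' $ j) - ln (\<alpha> t $ j))"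
    by (simp add: eta_eq_iff T)
  show ?thesis
    unfolding dominated
  proof
    assume "asym_geodesic unit_area_triangles eta 0 1 \<alpha>"
    then have add: "eta (\<alpha> u) (\<alpha> w) = eta (\<alpha> u) (\<alpha> v) + eta (\<alpha> v) (\<alpha> w)"
      if "0 \<le> u" "u \<le> v" "v \<le> w" "w \<le> 1" for u v w
      using that by (auto simp: asym_geodesic_def)
    obtain j where j: "eta (\<alpha> 0) (\<alpha> 1) = ln (\<alpha> 1 $ j) - ln (\<alpha> 0 $ j)"
      using eta_attained[OF T T, of 0 1] by auto
    \<comment> \<open>Cut [0,1] at t and t'. Over the three pieces the values of \<open>eta\<close>
      and the log ratios of coordinate \<open>j\<close> have the same sum, and each log ratio is at
      most the matching \<open>eta\<close>; hence equality holds on every piece, in particular on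
      the middle one.\<close>
    have "eta (\<alpha> t) (\<alpha> t') = ln (\<alpha> t' $ j) - ln (\<alpha> t $ j)"
      if t: "t \<in> {0..1}" "t' \<in> {0..1}" "t \<le> t'" for t t'
      using add[of 0 t' 1] add[of 0 t t'] j t
        ln_ratio_le_eta[OF T T, of 0 t j] ln_ratio_le_eta[OF T T, of t t' j]
        ln_ratio_le_eta[OF T T, of t' 1 j]
      by simp
    then show "\<exists>j. \<forall>t\<in>{0..1}. \<forall>t'\<in>{0..1}. t \<le> t' \<longrightarrow>
        eta (\<alpha> t) (\<alpha> t') = ln (\<alpha> t' $ j) - ln (\<alpha> t $ j)"
      by blast
  next
    assume "\<exists>j. \<forall>t\<in>{0..1}. \<forall>t'\<in>{0..1}. t \<le> t' \<longrightarrow>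
        eta (\<alpha> t) (\<alpha> t') = ln (\<alpha> t' $ j) - ln (\<alpha> t $ j)"
    \<comment> \<open>Piecewise C^1 includes continuity on [0,1], which supplies the path condition;
      additivity is then telescoping.\<close>
    moreover have "asym_path unit_area_triangles eta 0 1 \<alpha>"
      using assms
      by (intro continuous_on_imp_asym_path_eta)
        (auto simp: piecewise_C1_differentiable_on_def)
    ultimately show "asym_geodesic unit_area_triangles eta 0 1 \<alpha>"
      by (auto simp: asym_geodesic_def)
  qed
qed

end
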